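(* Let $\mathcal{H}$ be a complex separable Hilbert space, let $\mathcal{M}$ be a (not necessarily closed) subspace of $\mathcal{H}$, let $\mathcal{S}_1$ be a subspace of $\overline{\mathcal{M}}$ and $\mathcal{S}_2$ a subspace of $\mathcal{M}^\perp$, and let $x$ be a linear relation from $\mathcal{M}^\perp$ to $\overline{\mathcal{M}}$ with $\operatorname{ran}x\subseteq\mathcal{M}$. Let $$E:=\begin{pmatrix} I_{\mathcal{M}} & x\,\hat{+}\,(\{0\}\times\mathcal{S}_1)\\ 0\,\hat{+}\,(\{0\}\times\mathcal{S}_2) & 0\end{pmatrix}_{\overline{\mathcal{M}}}.$$ Then $E$ is idempotent (i.e. $E^2=E$) if and only if $x(\mathcal{S}_2)\subseteq\mathcal{S}_1+\operatorname{mul}x$.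
   Context: A linear relation from $\mathcal{H}$ to $\mathcal{K}$ is a linear subspace $T$ of $\mathcal{H}\times\mathcal{K}$; operators are identified with their graphs. $\operatorname{ran}T$ is the range, $\operatorname{mul}T=\{y:(0,y)\in T\}$, $RT=\{(x,y): (x,z)\in T,\ (z,y)\in R\text{ for some }z\}$, $T^2=TT$, $T\,\hat{+}\,S$ is the sum of $T$ and $S$ as subspaces of $\mathcal{H}\times\mathcal{K}$, and for a subspace $\mathcal{L}$, $T(\mathcal{L})=\{y:(u,y)\in T\text{ for some }u\in\mathcal{L}\}$. $I_{\mathcal{M}}=\{(m,m):m\in\mathcal{M}\}$, here regarded as a linear relation in $\overline{\mathcal{M}}\times\overline{\mathcal{M}}$. Block matrices: for a closed subspace $\mathcal{L}$ of $\mathcal{H}$ and linear relations $a$ from $\mathcal{L}$ to $\mathcal{L}$, $b$ from $\mathcal{L}^\perp$ to $\mathcal{L}$, $c$ from $\mathcal{L}$ to $\mathcal{L}^\perp$, $d$ from $\mathcal{L}^\perp$ to $\mathcal{L}^\perp$, $$\begin{pmatrix} a&b\\c&d\end{pmatrix}_{\mathcal{L}}:=\{(x_1+x_2,(w_1+z_1)+(w_2+z_2)):(x_1,w_1)\in a,\ (x_2,z_1)\in b,\ (x_1,w_2)\in c,\ (x_2,z_2)\in d\}.$$ In the matrix, $0$ denotes the everywhere defined zero operator between the corresponding subspaces (from $\overline{\mathcal{M}}$ to $\mathcal{M}^\perp$ in the $(2,1)$ entry, and on $\mathcal{M}^\perp$ in the $(2,2)$ entry). *)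

theory Defs
  imports "HOL-Analysis.Analysis" "HOL-Library.Set_Algebras"
begin

section \<open>Complex Hilbert spaces\<close>

class scaleC = scaleR +
  fixes scaleC :: "complex \<Rightarrow> 'a \<Rightarrow> 'a"  (infixr \<open>*\<^sub>C\<close> 75)
  assumes scaleR_scaleC: "scaleR r x = complex_of_real r *\<^sub>C x"

class complex_vector = scaleC + ab_group_add +
  assumes scaleC_add_right: "a *\<^sub>C (x + y) = a *\<^sub>C x + a *\<^sub>C y"
    and scaleC_add_left: "(a + b) *\<^sub>C x = a *\<^sub>C x + b *\<^sub>C x"
    and scaleC_scaleC: "a *\<^sub>C (b *\<^sub>C x) = (a * b) *\<^sub>C x"
    and scaleC_one: "1 *\<^sub>C x = x"
begin

subclass real_vector
  by standard
    (simp_all add: scaleR_scaleC scaleC_add_right scaleC_add_left scaleC_scaleC scaleC_one)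

end

text \<open>The inner product is antilinear in the first and linear in the second argument.\<close>

class complex_inner = complex_vector + real_normed_vector +
  fixes cinner :: "'a \<Rightarrow> 'a \<Rightarrow> complex"
  assumes cinner_commute: "cinner x y = cnj (cinner y x)"
    and cinner_add_right: "cinner x (y + z) = cinner x y + cinner x z"
    and cinner_scaleC_right: "cinner x (a *\<^sub>C y) = a * cinner x y"
    and norm_eq_sqrt_cinner: "norm x = sqrt (Re (cinner x x))"

class chilbert_space = complex_inner + complete_space

text \<open>Positive definiteness of \<open>cinner\<close> follows from the norm axioms: \<open>cinner x x\<close> is
  real by conjugate symmetry, and its real part is the square of the norm.\<close>

lemma cinner_self: "cinner x x = complex_of_real ((norm x)\<^sup>2)"
  for x :: "'a :: complex_inner"
proof -
  have "Im (cinner x x) = 0"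
    using cinner_commute[of x x] by (metis Reals_cnj_iff complex_is_Real_iff)
  moreover have "0 \<le> sqrt (Re (cinner x x))"
    using norm_ge_zero[of x] by (simp add: norm_eq_sqrt_cinner)
  ultimately show ?thesis
    by (simp add: norm_eq_sqrt_cinner complex_eq_iff)
qed

instantiation complex :: chilbert_space
begin

definition scaleC_complex :: "complex \<Rightarrow> complex \<Rightarrow> complex"
  where "scaleC_complex a x = a * x"

definition cinner_complex :: "complex \<Rightarrow> complex \<Rightarrow> complex"
  where "cinner_complex x y = cnj x * y"

instance
  by standard
    (auto simp: scaleC_complex_def cinner_complex_def scaleR_conv_of_real algebra_simps
      cmod_def power2_eq_square)

end

instantiation prod :: (complex_vector, complex_vector) complex_vector
begin

definition scaleC_prod :: "complex \<Rightarrow> 'a \<times> 'b \<Rightarrow> 'a \<times> 'b"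
  where "scaleC_prod c p = (c *\<^sub>C fst p, c *\<^sub>C snd p)"

instance
  by standard
    (auto simp: scaleC_prod_def scaleR_prod_def scaleR_scaleC scaleC_add_right scaleC_add_left
      scaleC_scaleC scaleC_one)

end

global_interpretation complex_vector:
  vector_space "scaleC :: complex \<Rightarrow> 'a \<Rightarrow> 'a :: complex_vector"
  by standard (simp_all add: scaleC_add_right scaleC_add_left scaleC_scaleC scaleC_one)

abbreviation csubspace :: "'a :: complex_vector set \<Rightarrow> bool"
  where "csubspace \<equiv> complex_vector.subspace"

definition orthocomp :: "'a :: complex_inner set \<Rightarrow> 'a set"
  where "orthocomp M = {y. \<forall>x\<in>M. cinner x y = 0}"


section \<open>Linear relations\<close>

text \<open>The product of relations \<open>RT\<close> is \<open>T O R\<close>, \<open>T(L)\<close> is \<open>T `` L\<close>, the range is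
  \<open>Range T\<close>, and both the sum of subspaces and the componentwise sum of relations
  are the sum \<open>+\<close> of sets.\<close>

definition linear_relation ::
    "'a :: complex_vector set \<Rightarrow> 'b :: complex_vector set \<Rightarrow> ('a \<times> 'b) set \<Rightarrow> bool"
  where "linear_relation H K T \<longleftrightarrow> csubspace T \<and> T \<subseteq> H \<times> K"

definition mul :: "('a :: zero \<times> 'b) set \<Rightarrow> 'b set"
  where "mul T = {y. (0, y) \<in> T}"

text \<open>The set below depends on the closed subspace \<open>L\<close> only through the entries, which are
  to be relations between the appropriate ones of \<open>L\<close> and \<open>orthocomp L\<close>; \<open>L\<close> is therefore
  not a parameter.\<close>

definition block_matrix ::
    "('a :: plus \<times> 'a) set \<Rightarrow> ('a \<times> 'a) set \<Rightarrow> ('a \<times> 'a) set \<Rightarrow> ('a \<times> 'a) set \<Rightarrow> ('a \<times> 'a) set"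
  where "block_matrix a b c d =
    {(x1 + x2, (w1 + z1) + (w2 + z2)) | x1 x2 w1 w2 z1 z2.
      (x1, w1) \<in> a \<and> (x2, z1) \<in> b \<and> (x1, w2) \<in> c \<and> (x2, z2) \<in> d}"

end

theory Submission
  imports Defs
begin

text \<open>\<open>E\<close> consists of the pairs \<open>(m + n, (m + z + s1) + s2)\<close> with \<open>m \<in> M\<close>, \<open>(n, z) \<in> x\<close>,
  \<open>s1 \<in> S1\<close> and \<open>s2 \<in> S2\<close>. Since \<open>closure M\<close> and \<open>orthocomp M\<close> meet only in \<open>0\<close>, a second
  element of \<open>E\<close> can start at \<open>(m + z + s1) + s2\<close> only with \<open>m + z + s1\<close> as its component
  in \<open>M\<close> and some \<open>(s2, z') \<in> x\<close>. So \<open>E O E\<close> differs from \<open>E\<close> only by an additional summand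
  \<open>z' \<in> x `` S2\<close>, which can be absorbed exactly if it lies in \<open>S1 + mul x\<close>.\<close>

text \<open>Real scalars act as complex ones. The real notion is enough for
  \<open>closure M\<close>, where only sums and differences are formed.\<close>

lemma csubspace_imp_subspace: "csubspace M \<Longrightarrow> subspace M"
  by (auto simp: subspace_def complex_vector.subspace_def scaleR_scaleC)

lemma subspace_closure:
  fixes M :: "'a :: real_normed_vector set"
  assumes "subspace M"
  shows "subspace (closure M)"
  unfolding subspace_def
proof (intro conjI ballI allI)
  show "0 \<in> closure M"
    using subspace_0[OF assms] closure_subset[of M] by auto
next
  fix a b assume "a \<in> closure M" "b \<in> closure M"
  then obtain f g where "\<And>n. f n \<in> M" "f \<longlonglongrightarrow> a" "\<And>n. g n \<in> M" "g \<longlonglongrightarrow> b"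
    unfolding closure_sequential by blast
  then show "a + b \<in> closure M"
    unfolding closure_sequential
    by (intro exI[of _ "\<lambda>n. f n + g n"]) (auto intro: tendsto_add subspace_add[OF assms])
next
  fix c a assume "a \<in> closure M"
  then obtain f where "\<And>n. f n \<in> M" "f \<longlonglongrightarrow> a"
    unfolding closure_sequential by blast
  then show "c *\<^sub>R a \<in> closure M"
    unfolding closure_sequential
    by (intro exI[of _ "\<lambda>n. c *\<^sub>R f n"]) (auto intro: tendsto_scaleR subspace_scale[OF assms])
qed

lemma csubspace_orthocomp: "csubspace (orthocomp M)"
proof -
  have "cinner x 0 = 0" for x :: 'a
    using cinner_add_right[of x 0 0] by simp
  then show ?thesis
    by (auto simp: complex_vector.subspace_def orthocomp_def cinner_add_right cinner_scaleC_right)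
qed

text \<open>By Pythagoras, the square of the right-hand side exceeds that of the left by the square
  of \<open>norm x\<close>.\<close>

lemma norm_le_norm_diff_if_orthogonal:
  fixes x y :: "'a :: complex_inner"
  assumes "cinner x y = 0"
  shows "norm y \<le> norm (x - y)"
proof -
  have "cinner y x = 0"
    using assms cinner_commute[of y x] by simp
  have diff: "cinner u (v - w) = cinner u v - cinner u w" for u v w :: 'a
    using cinner_add_right[of u "v - w" w] by simp
  have "cinner (x - y) x = cinner x x" "cinner (x - y) y = - cinner y y"
    using \<open>cinner x y = 0\<close> \<open>cinner y x = 0\<close>
    \<comment> \<open>Conjugate symmetry moves the difference into the second argument, where
      additivity is available.\<close>
    unfolding cinner_commute[of "x - y"] diff by (simp_all add: cinner_self)
  then have "cinner (x - y) (x - y) = cinner x x + cinner y y"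
    by (simp only: diff[of "x - y" x y]) simp
  then have "complex_of_real ((norm (x - y))\<^sup>2) = complex_of_real ((norm x)\<^sup>2 + (norm y)\<^sup>2)"
    by (simp add: cinner_self)
  then have "(norm (x - y))\<^sup>2 = (norm x)\<^sup>2 + (norm y)\<^sup>2"
    by (simp only: of_real_eq_iff)
  then have "(norm y)\<^sup>2 \<le> (norm (x - y))\<^sup>2"
    by simp
  then show ?thesis
    by (rule power2_le_imp_le) simp
qed

text \<open>A nonzero \<open>y\<close> in the closure has a point of \<open>M\<close> at distance
  less than \<open>norm y\<close>, but orthogonality keeps every point of \<open>M\<close> at least
  that far away.\<close>

lemma closure_Int_orthocomp_eq_zero:
  assumes "y \<in> closure M" "y \<in> orthocomp M"
  shows "y = 0"
proof (rule ccontr)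
  assume "y \<noteq> 0"
  then obtain m where "m \<in> M" "dist m y < norm y"
    using assms(1) by (metis closure_approachable zero_less_norm_iff)
  moreover have "norm y \<le> norm (m - y)"
    using assms(2) \<open>m \<in> M\<close> by (intro norm_le_norm_diff_if_orthogonal) (simp add: orthocomp_def)
  ultimately show False
    by (simp add: dist_norm)
qed

text \<open>The vector \<open>a - a' = b' - b\<close> lies in both subspaces, hence
  vanishes.\<close>

lemma closure_orthocomp_decomp_unique:
  assumes "csubspace M"
    and "a \<in> closure M" "a' \<in> closure M" "b \<in> orthocomp M" "b' \<in> orthocomp M"
    and "a + b = a' + b'"
  shows "a = a' \<and> b = b'"
proof -
  have "a - a' = b' - b"
    using assms(6) by (simp add: algebra_simps)
  moreover have "a - a' \<in> closure M"
    using assms(2,3) by (rule subspace_diff[OF subspace_closure[OF csubspace_imp_subspace[OF assms(1)]]])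
  moreover have "b' - b \<in> orthocomp M"
    using assms(5,4) by (rule complex_vector.subspace_diff[OF csubspace_orthocomp])
  ultimately show ?thesis
    using closure_Int_orthocomp_eq_zero[of "a - a'" M] assms(6) by auto
qed

theorem theorem3p20:
  fixes M S1 S2 :: "'h :: chilbert_space set"
    and x E :: "('h \<times> 'h) set"
  assumes "separable_space (euclidean :: 'h topology)"
    and "csubspace M"
    and "csubspace S1" and "S1 \<subseteq> closure M"
    and "csubspace S2" and "S2 \<subseteq> orthocomp M"
    and "linear_relation (orthocomp M) (closure M) x"
    and "Range x \<subseteq> M"
    and "E = block_matrix
               (Id_on M)                            (x + {0} \<times> S1)
               (closure M \<times> {0} + {0} \<times> S2)   (orthocomp M \<times> {0})"
  shows "E O E = E \<longleftrightarrow> x `` S2 \<subseteq> S1 + mul x"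
proof -
  note M = \<open>csubspace M\<close> and S1 = \<open>csubspace S1\<close> and S2 = \<open>csubspace S2\<close>
  have x: "csubspace x" and xsub: "x \<subseteq> orthocomp M \<times> closure M"
    using assms(7) by (auto simp: linear_relation_def)
  have x0: "(0, 0) \<in> x"
    using complex_vector.subspace_0[OF x] by (simp add: zero_prod_def)
  have xadd: "(u + u', v + v') \<in> x" if "(u, v) \<in> x" "(u', v') \<in> x" for u v u' v'
    using complex_vector.subspace_add[OF x that] by simp
  have zeros: "0 \<in> M" "0 \<in> S1" "0 \<in> S2"
    using M S1 S2 by (auto intro: complex_vector.subspace_0)
  have clM: "subspace (closure M)"
    by (rule subspace_closure[OF csubspace_imp_subspace[OF M]])
  have McM: "m \<in> closure M" if "m \<in> M" for m
    using that closure_subset[of M] by blast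
  have x_orth: "n \<in> orthocomp M" and x_M: "z \<in> M" if "(n, z) \<in> x" for n z
    using that xsub \<open>Range x \<subseteq> M\<close> by auto
  have E_intro: "(m + n, (m + z + s1) + s2) \<in> E"
    if "m \<in> M" "(n, z) \<in> x" "s1 \<in> S1" "s2 \<in> S2" for m n z s1 s2
  proof -
    have "(n, z) + (0, s1) \<in> x + {0} \<times> S1"
      using that by (intro set_plus_intro) auto
    moreover have "(m, 0) + (0, s2) \<in> closure M \<times> {0} + {0} \<times> S2"
      using that McM by (intro set_plus_intro) auto
    moreover have "(m, m) \<in> Id_on M" "(n, 0) \<in> orthocomp M \<times> {0}"
      using that x_orth by auto
    ultimately have "(m + n, (m + (z + s1)) + (s2 + 0)) \<in> E"
      unfolding assms(9) block_matrix_def mem_Collect_eq by (metis add_Pair add_0_left add_0_right)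
    then show ?thesis
      by (simp add: add.assoc)
  qed
  have E_elim: "\<exists>m n z s1 s2. m \<in> M \<and> (n, z) \<in> x \<and> s1 \<in> S1 \<and> s2 \<in> S2 \<and>
      p = m + n \<and> q = (m + z + s1) + s2" if pq: "(p, q) \<in> E" for p q
  proof -
    obtain x1 x2 w1 w2 z1 z2 where *: "(x1, w1) \<in> Id_on M" "(x2, z1) \<in> x + {0} \<times> S1"
        "(x1, w2) \<in> closure M \<times> {0} + {0} \<times> S2" "(x2, z2) \<in> orthocomp M \<times> {0}"
        "p = x1 + x2" "q = (w1 + z1) + (w2 + z2)"
      using pq unfolding assms(9) block_matrix_def by blast
    obtain z s1 where "(x2, z) \<in> x" "s1 \<in> S1" "z1 = z + s1"
      using *(2) by (auto elim!: set_plus_elim)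
    moreover have "w2 \<in> S2"
      using *(3) by (auto elim!: set_plus_elim)
    moreover have "x1 \<in> M" "w1 = x1" "z2 = 0"
      using *(1,4) by auto
    ultimately have "x1 \<in> M \<and> (x2, z) \<in> x \<and> s1 \<in> S1 \<and> w2 \<in> S2 \<and>
        p = x1 + x2 \<and> q = (x1 + z + s1) + w2"
      using *(5,6) by (simp add: add.assoc)
    then show ?thesis by blast
  qed
  have E_sub: "E \<subseteq> E O E"
  proof (rule subrelI)
    fix p q assume "(p, q) \<in> E"
    then obtain m n z s1 s2 where *: "m \<in> M" "(n, z) \<in> x" "s1 \<in> S1" "s2 \<in> S2"
        "p = m + n" "q = (m + z + s1) + s2"
      using E_elim by blast
    \<comment> \<open>The intermediate point is \<open>m + z\<close>: the first factor adds nothing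
      from \<open>S1\<close> and \<open>S2\<close>, the second adds \<open>s1\<close> and
      \<open>s2\<close>. It is in the domain of \<open>Id_on M\<close> because
      \<open>Range x \<subseteq> M\<close>.\<close>
    have "(p, m + z) \<in> E"
      using E_intro[of m n z 0 0] * zeros by simp
    moreover have "m + z \<in> M"
      using * x_M by (intro complex_vector.subspace_add[OF M])
    then have "(m + z, q) \<in> E"
      using E_intro[of "m + z" 0 0 s1 s2] * x0 by simp
    ultimately show "(p, q) \<in> E O E" ..
  qed
  show ?thesis
  proof
    assume idem: "E O E = E"
    show "x `` S2 \<subseteq> S1 + mul x"
    proof
      fix w assume "w \<in> x `` S2"
      then obtain s where s: "s \<in> S2" "(s, w) \<in> x" by auto
      \<comment> \<open>Passing through \<open>s\<close> shows that \<open>w\<close> lies in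
        \<open>mul (E O E)\<close>, so in \<open>mul E\<close> by idempotence.\<close>
      have "(0, s) \<in> E"
        using E_intro[of 0 0 0 0 s] s zeros x0 by simp
      moreover have "(s, w) \<in> E"
        using E_intro[of 0 s w 0 0] s zeros by simp
      ultimately have "(0, w) \<in> E" using idem by auto
      then obtain m n z s1 s2 where *: "m \<in> M" "(n, z) \<in> x" "s1 \<in> S1" "s2 \<in> S2"
          "0 = m + n" "w = (m + z + s1) + s2"
        using E_elim by blast
      have orth: "0 \<in> orthocomp M" "s2 \<in> orthocomp M"
        using complex_vector.subspace_0[OF csubspace_orthocomp] *(4) \<open>S2 \<subseteq> _\<close> by auto
      have "m = 0 \<and> n = 0"
        using closure_orthocomp_decomp_unique[OF M, of m 0 n 0]
          McM[OF *(1)] McM[OF zeros(1)] x_orth[OF *(2)] orth(1) *(5) by simp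
      moreover have "m + z + s1 \<in> closure M"
        using McM[OF *(1)] McM[OF x_M[OF *(2)]] *(3) \<open>S1 \<subseteq> _\<close>
        by (intro subspace_add[OF clM]) auto
      \<comment> \<open>As an element of \<open>Range x\<close>, \<open>w\<close> lies in
        \<open>M\<close>, so its component in \<open>orthocomp M\<close> is \<open>0\<close>. What
        remains is \<open>w = z + s1\<close> with \<open>(0, z) \<in> x\<close>.\<close>
      then have "s2 = 0"
        using closure_orthocomp_decomp_unique[OF M _ McM[OF x_M[OF s(2)]] orth(2,1)] *(6)
        by (metis add_0_right)
      ultimately show "w \<in> S1 + mul x"
        using set_plus_intro[of s1 S1 z "mul x"] * by (simp add: mul_def add.commute)
    qed
  next
    assume sub: "x `` S2 \<subseteq> S1 + mul x"
    have "E O E \<subseteq> E"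
    proof (rule subrelI)
      fix p r assume "(p, r) \<in> E O E"
      then obtain q where "(p, q) \<in> E" "(q, r) \<in> E" by auto
      then obtain m n z s1 s2 m' n' z' s1' s2'
        where *: "m \<in> M" "(n, z) \<in> x" "s1 \<in> S1" "s2 \<in> S2"
          "p = m + n" "q = (m + z + s1) + s2"
          and **: "m' \<in> M" "(n', z') \<in> x" "s1' \<in> S1" "s2' \<in> S2"
          "q = m' + n'" "r = (m' + z' + s1') + s2'"
        using E_elim by meson
      have "m + z + s1 \<in> closure M"
        using McM[OF *(1)] McM[OF x_M[OF *(2)]] *(3) \<open>S1 \<subseteq> _\<close>
        by (intro subspace_add[OF clM]) auto
      then have m': "m' = m + z + s1" and "n' = s2"
        using closure_orthocomp_decomp_unique[OF M, of "m + z + s1" m' s2 n']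
          *(4,6) **(5) McM[OF **(1)] x_orth[OF **(2)] \<open>S2 \<subseteq> _\<close> by auto
      then have "z' \<in> S1 + mul x"
        using sub * ** by blast
      then obtain t k where tk: "t \<in> S1" "(0, k) \<in> x" "z' = t + k"
        by (auto simp: mul_def set_plus_def)
      \<comment> \<open>The extra summand \<open>z' = t + k\<close> is absorbed: \<open>k\<close>
        from \<open>mul x\<close> joins \<open>z\<close> without changing \<open>n\<close>, and
        \<open>t\<close> joins the terms from \<open>S1\<close>.\<close>
      have "r = (m + (z + k) + (s1 + t + s1')) + s2'"
        using ** m' tk by (simp add: algebra_simps)
      moreover have "(n, z + k) \<in> x"
        using xadd[OF \<open>(n, z) \<in> x\<close> tk(2)] by simp
      moreover have "s1 + t + s1' \<in> S1"
        using * ** tk by (intro complex_vector.subspace_add[OF S1])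
      ultimately show "(p, r) \<in> E"
        using E_intro[OF *(1) _ _ **(4)] *(5) by metis
    qed
    then show "E O E = E"
      using E_sub by blast
  qed
qed

end
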